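(* The only rotational surfaces (with axis of revolution the $z$-axis) whose principal curvatures satisfy $k_{\mathrm m}=\mu\,k_{\mathrm p}^3$ for a constant $\mu\neq 0$ are the plane and the non-degenerate quadric surfaces of revolution. That is: (i) if $S_\alpha$ is a rotational surface satisfying $k_{\mathrm m}=\mu\,k_{\mathrm p}^3$ at every point for some real constant $\mu\neq0$, then, up to a translation along the $z$-axis, $S_\alpha$ is an open piece of a horizontal plane or of a non-degenerate quadric surface of revolution; (ii) conversely, the horizontal planes and all non-degenerate quadric surfaces of revolution satisfy $k_{\mathrm m}=\mu\,k_{\mathrm p}^3$ for some real constant $\mu\neq 0$.
   Context: Rotational surfaces: let $\alpha(s)=(x(s),z(s))$, $s\in I$ ($I\subseteq\mathbb{R}$ an open interval), be a smooth curve in the $xz$-plane parametrized by arc length ($\dot x^2+\dot z^2=1$) with $x>0$. The rotational surface $S_\alpha\subset\mathbb{R}^3$ with generatrix $\alpha$ is the surface generated by rotating $\alpha$ around the $z$-axis, parametrized by $X(s,\theta)=(x(s)\cos\theta,\,x(s)\sin\theta,\,z(s))$. The principal curvatures of $S_\alpha$ (along meridians and parallels respectively) are $k_{\mathrm m}=\kappa$ and $k_{\mathrm p}=\dot z/x$, where $\kappa=\dot x\ddot z-\dot z\ddot x$ is the signed curvature of $\alpha$. (Reversing the orientation of $\alpha$ changes the sign of both.) The non-degenerate quadric surfaces of revolution (with axis the $z$-axis) are, up to translations along the $z$-axis and with $a,b>0$: the ellipsoids $\frac{x^2+y^2}{a^2}+\frac{z^2}{b^2}=1$ (including spheres, $a=b$),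 the one-sheet hyperboloids $\frac{x^2+y^2}{a^2}-\frac{z^2}{b^2}=1$, the two-sheets hyperboloids $-\frac{x^2+y^2}{a^2}+\frac{z^2}{b^2}=1$, and the paraboloids $z=\pm\frac{x^2+y^2}{2a}$. In (ii) the relation is understood at points off the axis of revolution, on each connected component of the surface. *)

theory Defs
  imports "HOL-Analysis.Analysis"
begin

(* Smoothness of class C^infinity. It is only used for open I, where the iterates of deriv
   at points of I depend on the values of f on I alone. *)
definition smooth_on :: "real set \<Rightarrow> (real \<Rightarrow> real) \<Rightarrow> bool" where
  "smooth_on I f \<longleftrightarrow> (\<forall>n. \<forall>s\<in>I. (deriv ^^ n) f differentiable (at s))"

definition generatrix :: "real set \<Rightarrow> (real \<Rightarrow> real) \<Rightarrow> (real \<Rightarrow> real) \<Rightarrow> bool" where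
  "generatrix I x z \<longleftrightarrow>
     open I \<and> is_interval I \<and> I \<noteq> {} \<and>
     smooth_on I x \<and> smooth_on I z \<and>
     (\<forall>s\<in>I. (deriv x s)\<^sup>2 + (deriv z s)\<^sup>2 = 1) \<and>
     (\<forall>s\<in>I. 0 < x s)"

definition rotational_surface :: "real set \<Rightarrow> (real \<Rightarrow> real) \<Rightarrow> (real \<Rightarrow> real) \<Rightarrow> (real^3) set" where
  "rotational_surface I x z =
     {vector [x s * cos \<theta>, x s * sin \<theta>, z s] |s \<theta>. s \<in> I}"

definition k_m :: "(real \<Rightarrow> real) \<Rightarrow> (real \<Rightarrow> real) \<Rightarrow> real \<Rightarrow> real" where
  "k_m x z s = deriv x s * deriv (deriv z) s - deriv z s * deriv (deriv x) s"

definition k_p :: "(real \<Rightarrow> real) \<Rightarrow> (real \<Rightarrow> real) \<Rightarrow> real \<Rightarrow> real" where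
  "k_p x z s = deriv z s / x s"

definition z_axis :: "(real^3) set" where
  "z_axis = {p. p$1 = 0 \<and> p$2 = 0}"

definition horizontal_plane :: "(real^3) set \<Rightarrow> bool" where
  "horizontal_plane Q \<longleftrightarrow> (\<exists>h. Q = {p. p$3 = h})"

definition ellipsoid :: "real \<Rightarrow> real \<Rightarrow> (real^3) set" where
  "ellipsoid a b = {p. ((p$1)\<^sup>2 + (p$2)\<^sup>2) / a\<^sup>2 + (p$3)\<^sup>2 / b\<^sup>2 = 1}"

definition one_sheet_hyperboloid :: "real \<Rightarrow> real \<Rightarrow> (real^3) set" where
  "one_sheet_hyperboloid a b = {p. ((p$1)\<^sup>2 + (p$2)\<^sup>2) / a\<^sup>2 - (p$3)\<^sup>2 / b\<^sup>2 = 1}"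

definition two_sheets_hyperboloid :: "real \<Rightarrow> real \<Rightarrow> (real^3) set" where
  "two_sheets_hyperboloid a b = {p. - (((p$1)\<^sup>2 + (p$2)\<^sup>2) / a\<^sup>2) + (p$3)\<^sup>2 / b\<^sup>2 = 1}"

definition upward_paraboloid :: "real \<Rightarrow> (real^3) set" where
  "upward_paraboloid a = {p. p$3 = ((p$1)\<^sup>2 + (p$2)\<^sup>2) / (2 * a)}"

definition downward_paraboloid :: "real \<Rightarrow> (real^3) set" where
  "downward_paraboloid a = {p. p$3 = - (((p$1)\<^sup>2 + (p$2)\<^sup>2) / (2 * a))}"

definition nondegenerate_quadric_of_revolution :: "(real^3) set \<Rightarrow> bool" where
  "nondegenerate_quadric_of_revolution Q \<longleftrightarrow>
     (\<exists>h a b. a > 0 \<and> b > 0 \<and>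
        (\<exists>Q\<^sub>0 \<in> {ellipsoid a b, one_sheet_hyperboloid a b, two_sheets_hyperboloid a b,
                  upward_paraboloid a, downward_paraboloid a}.
           Q = (\<lambda>p. p + vector [0, 0, h]) ` Q\<^sub>0))"

(* Q satisfies k_m = mu k_p^3 off the axis: each connected component of Q, with the axis removed,
   is a rotational surface, and the relation holds for every generatrix of it. The relation is
   insensitive to the orientation of the generatrix, since k_m and k_p change sign together. *)
definition satisfies_cubic_relation :: "real \<Rightarrow> (real^3) set \<Rightarrow> bool" where
  "satisfies_cubic_relation \<mu> Q \<longleftrightarrow>
     (\<forall>C\<in>components Q.
        (\<exists>I x z. generatrix I x z \<and> rotational_surface I x z = C - z_axis) \<and>
        (\<forall>I x z. generatrix I x z \<and> rotational_surface I x z = C - z_axis \<longrightarrow>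
           (\<forall>s\<in>I. k_m x z s = \<mu> * (k_p x z s)^3)))"

end

theory Submission
  imports Defs
begin

text \<open>
  All non-degenerate quadrics of revolution about the \<open>z\<close>-axis have one common form: the squared
  distance to the axis is a polynomial of degree at most two in the height,
  \<open>x\<^sup>2 + y\<^sup>2 = \<delta> z\<^sup>2 + 2 \<epsilon> z + \<phi>\<close>, with nonzero discriminant \<open>\<mu> = \<epsilon>\<^sup>2 - \<delta> \<phi>\<close>; and this
  discriminant is exactly the constant in \<open>k\<^sub>m = \<mu> k\<^sub>p\<^sup>3\<close>. The case distinction between ellipsoids,
  hyperboloids and paraboloids is confined to \<open>nondegenerate_imp_quadric\<close> and
  \<open>quadric_imp_nondegenerate\<close>.

  Let a generatrix satisfy the relation, and write \<open>p\<close>, \<open>q\<close> for the derivatives of \<open>x\<close>, \<open>z\<close>. By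
  Frenet's formulas \<open>q' = p k\<^sub>m = \<mu> p q\<^sup>3 / x\<^sup>3\<close>. This is a linear homogeneous equation for \<open>q\<close>
  with coefficient \<open>\<mu> p q\<^sup>2 / x\<^sup>3\<close>, so \<open>q\<close> vanishes identically, which gives a plane, or nowhere.
  In the second case \<open>1/q\<^sup>2 - \<mu>/x\<^sup>2\<close> is a constant \<open>\<delta> + 1\<close>, from which \<open>(x p / q)' = \<delta> q = \<delta> z'\<close>,
  hence \<open>x p = (\<delta> z + \<epsilon>) q\<close>, and a last integration gives \<open>x\<^sup>2 = \<delta> z\<^sup>2 + 2 \<epsilon> z + \<phi>\<close>. These
  integrations never divide by \<open>p\<close>, so points with \<open>p = 0\<close>, such as an equator, need no special
  care. As \<open>z\<close> is injective and open, and \<open>x\<close> is determined by \<open>z\<close>, the surface is the part of the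
  quadric over an open set of heights.

  Conversely, differentiating \<open>x\<^sup>2 = \<delta> z\<^sup>2 + 2 \<epsilon> z + \<phi>\<close> twice along a generatrix gives the relation
  (\<open>cubic_relation_on_quadric\<close>). It remains to see that each component of a quadric, without its
  points on the axis, is a rotational surface. A component is the part of the quadric over a maximal
  interval of heights on which the polynomial is nonnegative. The discriminant is nonzero, so zeros of
  the polynomial are simple and occur only at ends of that interval; removing them leaves an open
  interval (\<open>component_off_axis_slab\<close>). Over it the profile is a graph over the height, which is
  parametrized by arc length in \<open>generatrix_over_interval\<close>.
\<close>

section \<open>Smooth functions from polynomial differential systems\<close>

lemma smooth_on_closed_family:
  assumes "open I" and "f \<in> F"
    and closed: "\<And>g. g \<in> F \<Longrightarrow> \<exists>g'\<in>F. \<forall>s\<in>I. (g has_real_derivative g' s) (at s)"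
  shows "smooth_on I f"
proof -
  have "\<exists>g\<in>F. \<forall>s\<in>I. (deriv ^^ n) f s = g s" for n
  proof (induction n)
    case 0
    show ?case using \<open>f \<in> F\<close> by auto
  next
    case (Suc n)
    then obtain g where g: "g \<in> F" "\<forall>s\<in>I. (deriv ^^ n) f s = g s" by blast
    obtain g' where g': "g' \<in> F" "\<forall>s\<in>I. (g has_real_derivative g' s) (at s)"
      using closed[OF g(1)] by blast
    have "((deriv ^^ n) f has_real_derivative g' s) (at s)" if "s \<in> I" for s
      using has_field_derivative_transform_within_open[of g "g' s" s I] g(2) g'(2) that \<open>open I\<close>
      by metis
    then show ?case using g'(1) by (auto intro!: bexI[of _ g'] DERIV_imp_deriv)
  qed
  moreover have "(deriv ^^ n) f differentiable at s"
    if "g \<in> F" "\<forall>s\<in>I. (deriv ^^ n) f s = g s" "s \<in> I" for g n s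
    using has_field_derivative_transform_within_open[of g _ s I] closed[OF that(1)] that \<open>open I\<close>
    by (metis real_differentiable_def)
  ultimately show ?thesis unfolding smooth_on_def by blast
qed

text \<open>
  The algebra generated by a set of functions under pointwise operations. It serves to show
  smoothness of the solutions of a system whose right-hand sides are polynomials in the unknowns:
  all further derivatives then stay in the algebra.
\<close>

inductive_set poly_algebra :: "(real \<Rightarrow> real) set \<Rightarrow> (real \<Rightarrow> real) set" for G where
  const: "(\<lambda>_. c) \<in> poly_algebra G"
| gen: "g \<in> G \<Longrightarrow> g \<in> poly_algebra G"
| add: "f \<in> poly_algebra G \<Longrightarrow> g \<in> poly_algebra G \<Longrightarrow> (\<lambda>s. f s + g s) \<in> poly_algebra G"
| mult: "f \<in> poly_algebra G \<Longrightarrow> g \<in> poly_algebra G \<Longrightarrow> (\<lambda>s. f s * g s) \<in> poly_algebra G"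

lemma smooth_on_polynomial_system:
  assumes "open I" and "f \<in> G"
    and system: "\<And>g. g \<in> G \<Longrightarrow>
      \<exists>g'\<in>poly_algebra G. \<forall>s\<in>I. (g has_real_derivative g' s) (at s)"
  shows "smooth_on I f"
proof (rule smooth_on_closed_family[OF \<open>open I\<close> poly_algebra.gen[OF \<open>f \<in> G\<close>]])
  fix h assume "h \<in> poly_algebra G"
  then show "\<exists>h'\<in>poly_algebra G. \<forall>s\<in>I. (h has_real_derivative h' s) (at s)"
  proof induction
    case (const c)
    show ?case by (rule bexI[OF _ poly_algebra.const[of 0]]) auto
  next
    case (gen g)
    then show ?case by (rule system)
  next
    case (add f g)
    then obtain f' g' where "f' \<in> poly_algebra G" "g' \<in> poly_algebra G"
      "\<forall>s\<in>I. (f has_real_derivative f' s) (at s)" "\<forall>s\<in>I. (g has_real_derivative g' s) (at s)"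
      by blast
    then show ?case
      by (intro bexI[of _ "\<lambda>s. f' s + g' s"]) (auto intro: poly_algebra.add DERIV_add)
  next
    case (mult f g)
    then obtain f' g' where "f' \<in> poly_algebra G" "g' \<in> poly_algebra G"
      "\<forall>s\<in>I. (f has_real_derivative f' s) (at s)" "\<forall>s\<in>I. (g has_real_derivative g' s) (at s)"
      by blast
    with mult.hyps show ?case
      by (intro bexI[of _ "\<lambda>s. f' s * g s + g' s * f s"])
        (auto intro!: poly_algebra.add poly_algebra.mult DERIV_mult)
  qed
qed

section \<open>Derivatives along a generatrix\<close>

lemma smooth_on_imp_derivs:
  assumes "smooth_on I f" "s \<in> I"
  shows "(f has_real_derivative deriv f s) (at s)"
    and "(deriv f has_real_derivative deriv (deriv f) s) (at s)"
proof -
  have "(deriv ^^ 0) f differentiable at s" "(deriv ^^ 1) f differentiable at s"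
    using assms unfolding smooth_on_def by blast+
  then show "(f has_real_derivative deriv f s) (at s)"
    and "(deriv f has_real_derivative deriv (deriv f) s) (at s)"
    by (auto simp: DERIV_deriv_iff_real_differentiable)
qed

text \<open>
  Frenet's formulas: the acceleration is orthogonal to the unit tangent, hence a multiple of the
  normal, and \<open>k_m\<close> is the factor.
\<close>

lemma generatrix_frenet:
  assumes "generatrix I x z" "s \<in> I"
  shows "deriv (deriv x) s = - deriv z s * k_m x z s"
    and "deriv (deriv z) s = deriv x s * k_m x z s"
proof -
  have I: "open I" and sm: "smooth_on I x" "smooth_on I z"
    and unit: "\<And>t. t \<in> I \<Longrightarrow> (deriv x t)\<^sup>2 + (deriv z t)\<^sup>2 = 1"
    using assms unfolding generatrix_def by auto
  let ?D = "2 * deriv x s * deriv (deriv x) s + 2 * deriv z s * deriv (deriv z) s"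
  have "((\<lambda>t. (deriv x t)\<^sup>2 + (deriv z t)\<^sup>2) has_real_derivative ?D) (at s)"
    by (auto intro!: derivative_eq_intros smooth_on_imp_derivs sm assms(2))
  moreover have "((\<lambda>t. (deriv x t)\<^sup>2 + (deriv z t)\<^sup>2) has_real_derivative 0) (at s)"
    using has_field_derivative_transform_within_open[of "\<lambda>_. 1" 0 s I
        "\<lambda>t. (deriv x t)\<^sup>2 + (deriv z t)\<^sup>2"] I unit assms(2) by auto
  ultimately have "?D = 0" by (rule DERIV_unique)
  then have ort: "deriv x s * deriv (deriv x) s + deriv z s * deriv (deriv z) s = 0" by simp
  have u: "(deriv x s)\<^sup>2 + (deriv z s)\<^sup>2 = 1" using unit assms(2) by simp
  show "deriv (deriv x) s = - deriv z s * k_m x z s"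
    using ort u unfolding k_m_def by algebra
  show "deriv (deriv z) s = deriv x s * k_m x z s"
    using ort u unfolding k_m_def by algebra
qed

section \<open>Quadrics of revolution in a common form\<close>

definition profile :: "real \<Rightarrow> real \<Rightarrow> real \<Rightarrow> real \<Rightarrow> real" where
  "profile \<delta> \<epsilon> \<phi> t = \<delta> * t\<^sup>2 + 2 * \<epsilon> * t + \<phi>"

definition quadric :: "real \<Rightarrow> real \<Rightarrow> real \<Rightarrow> (real^3) set" where
  "quadric \<delta> \<epsilon> \<phi> = {p. (p$1)\<^sup>2 + (p$2)\<^sup>2 = profile \<delta> \<epsilon> \<phi> (p$3)}"

lemma profile_has_derivative:
  "(profile \<delta> \<epsilon> \<phi> has_real_derivative 2 * (\<delta> * t + \<epsilon>)) (at t)"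
  unfolding profile_def[abs_def] by (auto intro!: derivative_eq_intros)

text \<open>
  Completing the square. Since \<open>\<delta> t + \<epsilon>\<close> is half the derivative of the profile, a nonzero
  discriminant means that zeros of the profile are simple; along a generatrix the identity turns the
  slope into a function of the radius.
\<close>

lemma profile_discriminant:
  "(\<delta> * t + \<epsilon>)\<^sup>2 = \<epsilon>\<^sup>2 - \<delta> * \<phi> + \<delta> * profile \<delta> \<epsilon> \<phi> t"
  unfolding profile_def by (simp add: power2_eq_square algebra_simps)

lemma vec3_eq_iff: "p = q \<longleftrightarrow> p$1 = q$1 \<and> p$2 = q$2 \<and> p$3 = q$3" for p q :: "real^3"
  by (simp add: vec_eq_iff forall_3)

lemma translated_image:
  "(\<lambda>p. p + vector [0, 0, h]) ` S = {p :: real^3. vector [p$1, p$2, p$3 - h] \<in> S}"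
proof -
  have "p + vector [0, 0, h] - vector [0, 0, h] = p" for p :: "real^3" by simp
  have 1: "vector [p$1, p$2, p$3 - h] = p - vector [0, 0, h]" for p :: "real^3"
    by (simp add: vec3_eq_iff vector_3)
  show ?thesis unfolding 1 by (force simp: image_iff algebra_simps)
qed

text \<open>
  Solving the equation of each quadric for \<open>x\<^sup>2 + y\<^sup>2\<close> gives \<open>\<delta> t\<^sup>2 + c\<close> in the three cases with a
  centre and \<open>2 \<epsilon> t\<close> in the two parabolic ones, where \<open>t\<close> is the height above the centre or vertex.
\<close>

lemma nondegenerate_imp_quadric:
  assumes "nondegenerate_quadric_of_revolution Q"
  shows "\<exists>\<delta> \<epsilon> \<phi>. \<epsilon>\<^sup>2 - \<delta> * \<phi> \<noteq> 0 \<and> Q = quadric \<delta> \<epsilon> \<phi>"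
proof -
  obtain h a b Q0 where ab: "a > 0" "b > 0"
    and Q0: "Q0 \<in> {ellipsoid a b, one_sheet_hyperboloid a b, two_sheets_hyperboloid a b,
                  upward_paraboloid a, downward_paraboloid a}"
    and Q: "Q = (\<lambda>p. p + vector [0, 0, h]) ` Q0"
    using assms unfolding nondegenerate_quadric_of_revolution_def by blast
  have centred: ?thesis if "\<delta> \<noteq> 0" "c \<noteq> 0"
      "\<And>u v t. vector [u, v, t] \<in> Q0 \<longleftrightarrow> u\<^sup>2 + v\<^sup>2 = \<delta> * t\<^sup>2 + c" for \<delta> c
  proof (intro exI conjI)
    show "(- \<delta> * h)\<^sup>2 - \<delta> * (\<delta> * h\<^sup>2 + c) \<noteq> 0"
      using that(1,2) by (simp add: power2_eq_square algebra_simps)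
    show "Q = quadric \<delta> (- \<delta> * h) (\<delta> * h\<^sup>2 + c)"
      unfolding Q translated_image that(3) quadric_def profile_def
      by (simp add: power2_eq_square algebra_simps)
  qed
  have parabolic: ?thesis if "\<epsilon> \<noteq> 0"
      "\<And>u v t. vector [u, v, t] \<in> Q0 \<longleftrightarrow> u\<^sup>2 + v\<^sup>2 = 2 * \<epsilon> * t" for \<epsilon>
  proof (intro exI conjI)
    show "\<epsilon>\<^sup>2 - 0 * (- 2 * \<epsilon> * h) \<noteq> 0"
      using that(1) by simp
    show "Q = quadric 0 \<epsilon> (- 2 * \<epsilon> * h)"
      unfolding Q translated_image that(2) quadric_def profile_def
      by (simp add: algebra_simps)
  qed
  consider "Q0 = ellipsoid a b" | "Q0 = one_sheet_hyperboloid a b"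
    | "Q0 = two_sheets_hyperboloid a b" | "Q0 = upward_paraboloid a" | "Q0 = downward_paraboloid a"
    using Q0 by blast
  then show ?thesis
  proof cases
    case 1
    show ?thesis
      by (rule centred[of "- (a\<^sup>2 / b\<^sup>2)" "a\<^sup>2"])
        (use ab in \<open>auto simp: 1 ellipsoid_def vector_3 field_simps\<close>)
  next
    case 2
    show ?thesis
      by (rule centred[of "a\<^sup>2 / b\<^sup>2" "a\<^sup>2"])
        (use ab in \<open>auto simp: 2 one_sheet_hyperboloid_def vector_3 field_simps\<close>)
  next
    case 3
    show ?thesis
      by (rule centred[of "a\<^sup>2 / b\<^sup>2" "- (a\<^sup>2)"])
        (use ab in \<open>auto simp: 3 two_sheets_hyperboloid_def vector_3 field_simps\<close>)
  next
    case 4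
    show ?thesis
      by (rule parabolic[of a])
        (use ab in \<open>auto simp: 4 upward_paraboloid_def vector_3 field_simps\<close>)
  next
    case 5
    show ?thesis
      by (rule parabolic[of "- a"])
        (use ab in \<open>auto simp: 5 downward_paraboloid_def vector_3 field_simps\<close>)
  qed
qed

text \<open>
  With \<open>m\<close> the discriminant, the type of the quadric is read off from the signs of \<open>\<delta>\<close> and \<open>m\<close>.
  If both are negative the profile is negative everywhere, so this case is excluded by the
  hypothesis that the quadric has a point.
\<close>

lemma quadric_imp_nondegenerate:
  assumes "\<epsilon>\<^sup>2 - \<delta> * \<phi> \<noteq> 0" and "quadric \<delta> \<epsilon> \<phi> \<noteq> {}"
  shows "nondegenerate_quadric_of_revolution (quadric \<delta> \<epsilon> \<phi>)"
proof -
  define m where "m = \<epsilon>\<^sup>2 - \<delta> * \<phi>"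
  have "m \<noteq> 0" using assms(1) by (simp add: m_def)
  have nondeg: ?thesis
    if "a > 0" "b > 0"
      "Q0 \<in> {ellipsoid a b, one_sheet_hyperboloid a b, two_sheets_hyperboloid a b,
             upward_paraboloid a, downward_paraboloid a}"
      "\<And>u v t. vector [u, v, t - h] \<in> Q0 \<longleftrightarrow> u\<^sup>2 + v\<^sup>2 = profile \<delta> \<epsilon> \<phi> t" for a b h Q0
  proof -
    have "quadric \<delta> \<epsilon> \<phi> = (\<lambda>p. p + vector [0, 0, h]) ` Q0"
      unfolding translated_image quadric_def that(4) ..
    then show ?thesis
      unfolding nondegenerate_quadric_of_revolution_def using that(1-3) by blast
  qed
  show ?thesis
  proof (cases "\<delta> = 0")
    case True
    then have "\<epsilon> \<noteq> 0" using \<open>m \<noteq> 0\<close> by (auto simp: m_def)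
    define h where "h = - \<phi> / (2 * \<epsilon>)"
    have vertex: "profile \<delta> \<epsilon> \<phi> t = 2 * \<epsilon> * (t - h)" for t
      using \<open>\<epsilon> \<noteq> 0\<close> by (simp add: profile_def h_def True field_simps)
    consider "\<epsilon> > 0" | "\<epsilon> < 0" using \<open>\<epsilon> \<noteq> 0\<close> by linarith
    then show ?thesis
    proof cases
      case 1
      show ?thesis
        by (rule nondeg[of \<epsilon> 1 "upward_paraboloid \<epsilon>" h])
          (use 1 in \<open>auto simp: upward_paraboloid_def vertex field_simps\<close>)
    next
      case 2
      show ?thesis
        by (rule nondeg[of "- \<epsilon>" 1 "downward_paraboloid (- \<epsilon>)" h])
          (use 2 in \<open>auto simp: downward_paraboloid_def vertex field_simps\<close>)
    qed
  next
    case False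
    define h where "h = - \<epsilon> / \<delta>"
    have centre: "profile \<delta> \<epsilon> \<phi> t = \<delta> * (t - h)\<^sup>2 - m / \<delta>" for t
      using False by (simp add: profile_def h_def m_def power2_eq_square field_simps)
    have conic: "- (\<delta> * S / m) + \<delta>\<^sup>2 * T / m = 1 \<longleftrightarrow> S = \<delta> * T - m / \<delta>" for S T
      using False \<open>m \<noteq> 0\<close> by (auto simp: field_simps power2_eq_square)
    obtain p :: "real^3" where p: "(p$1)\<^sup>2 + (p$2)\<^sup>2 = \<delta> * (p$3 - h)\<^sup>2 - m / \<delta>"
      using assms(2) centre unfolding quadric_def by auto
    have "\<not> (\<delta> < 0 \<and> m < 0)"
    proof
      assume neg: "\<delta> < 0 \<and> m < 0"
      then have "m / \<delta> > 0" by (simp add: divide_neg_neg)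
      moreover have "\<delta> * (p$3 - h)\<^sup>2 \<le> 0" using neg by (simp add: mult_nonpos_nonneg)
      ultimately show False using p sum_power2_ge_zero[of "p$1" "p$2"] by linarith
    qed
    then consider "\<delta> > 0" "m > 0" | "\<delta> > 0" "m < 0" | "\<delta> < 0" "m > 0"
      using False \<open>m \<noteq> 0\<close> by linarith
    then show ?thesis
    proof cases
      case 1
      then have sq: "(sqrt (m / \<delta>))\<^sup>2 = m / \<delta>" "(sqrt m / \<delta>)\<^sup>2 = m / \<delta>\<^sup>2"
        by (auto simp: power_divide)
      show ?thesis
      proof (rule nondeg[of "sqrt (m / \<delta>)" "sqrt m / \<delta>"
            "two_sheets_hyperboloid (sqrt (m / \<delta>)) (sqrt m / \<delta>)" h])
        show "vector [u, v, t - h] \<in> two_sheets_hyperboloid (sqrt (m / \<delta>)) (sqrt m / \<delta>)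
          \<longleftrightarrow> u\<^sup>2 + v\<^sup>2 = profile \<delta> \<epsilon> \<phi> t" for u v t
          unfolding two_sheets_hyperboloid_def centre mem_Collect_eq vector_3 sq
          using conic[of "u\<^sup>2 + v\<^sup>2" "(t - h)\<^sup>2"] by (simp add: mult.commute)
      qed (use 1 in auto)
    next
      case 2
      then have sq: "(sqrt (- m / \<delta>))\<^sup>2 = - m / \<delta>" "(sqrt (- m) / \<delta>)\<^sup>2 = - m / \<delta>\<^sup>2"
        by (auto simp: power_divide divide_nonpos_pos)
      show ?thesis
      proof (rule nondeg[of "sqrt (- m / \<delta>)" "sqrt (- m) / \<delta>"
            "one_sheet_hyperboloid (sqrt (- m / \<delta>)) (sqrt (- m) / \<delta>)" h])
        show "vector [u, v, t - h] \<in> one_sheet_hyperboloid (sqrt (- m / \<delta>)) (sqrt (- m) / \<delta>)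
          \<longleftrightarrow> u\<^sup>2 + v\<^sup>2 = profile \<delta> \<epsilon> \<phi> t" for u v t
          unfolding one_sheet_hyperboloid_def centre mem_Collect_eq vector_3 sq
          using conic[of "u\<^sup>2 + v\<^sup>2" "(t - h)\<^sup>2"] by (simp add: mult.commute)
      qed (use 2 in \<open>auto simp: divide_neg_pos\<close>)
    next
      case 3
      then have sq: "(sqrt (- m / \<delta>))\<^sup>2 = - m / \<delta>" "(sqrt m / (- \<delta>))\<^sup>2 = m / \<delta>\<^sup>2"
        by (auto simp: power_divide divide_nonpos_neg divide_nonneg_neg)
      show ?thesis
      proof (rule nondeg[of "sqrt (- m / \<delta>)" "sqrt m / (- \<delta>)"
            "ellipsoid (sqrt (- m / \<delta>)) (sqrt m / (- \<delta>))" h])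
        show "vector [u, v, t - h] \<in> ellipsoid (sqrt (- m / \<delta>)) (sqrt m / (- \<delta>))
          \<longleftrightarrow> u\<^sup>2 + v\<^sup>2 = profile \<delta> \<epsilon> \<phi> t" for u v t
          unfolding ellipsoid_def centre mem_Collect_eq vector_3 sq
          using conic[of "u\<^sup>2 + v\<^sup>2" "(t - h)\<^sup>2"] by (simp add: mult.commute)
      qed (use 3 in \<open>auto simp: divide_pos_neg\<close>)
    qed
  qed
qed


section \<open>Calculus on open intervals\<close>

lemma open_interval_antiderivative:
  fixes f :: "real \<Rightarrow> real"
  assumes J: "open J" "is_interval J" and cont: "continuous_on J f"
  obtains F where "\<And>t. t \<in> J \<Longrightarrow> (F has_real_derivative f t) (at t)"
proof (cases "J = {}")
  case False
  \<comment> \<open>Extended real endpoints treat bounded and unbounded intervals alike.\<close>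
  define a b where "a = Inf (ereal ` J)" and "b = Sup (ereal ` J)"
  have mem: "a < ereal t \<and> ereal t < b \<longleftrightarrow> t \<in> J" for t
  proof
    assume "a < ereal t \<and> ereal t < b"
    then obtain u v where "u \<in> J" "v \<in> J" "u < t" "t < v"
      unfolding a_def b_def by (auto simp: Inf_less_iff less_Sup_iff)
    then show "t \<in> J" using J(2) by (meson is_interval_1 less_imp_le)
  next
    assume "t \<in> J"
    then obtain e where "e > 0" "ball t e \<subseteq> J" using J(1) openE by blast
    then have "t - e / 2 \<in> J" "t + e / 2 \<in> J" by (auto simp: subset_iff dist_real_def)
    then have "a \<le> ereal (t - e / 2)" "ereal (t + e / 2) \<le> b"
      unfolding a_def b_def by (auto intro: Inf_lower Sup_upper)
    moreover have "ereal (t - e / 2) < ereal t" "ereal t < ereal (t + e / 2)"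
      using \<open>e > 0\<close> by auto
    ultimately show "a < ereal t \<and> ereal t < b"
      by (blast intro: le_less_trans less_le_trans)
  qed
  moreover from False mem have "a < b" by force
  moreover have "isCont f t" if "t \<in> J" for t
    using cont J(1) that continuous_on_eq_continuous_at by blast
  ultimately obtain F where "\<forall>t. t \<in> J \<longrightarrow> (F has_vector_derivative f t) (at t)"
    using einterval_antiderivative[of a b f] by metis
  then show ?thesis
    using that unfolding has_real_derivative_iff_has_vector_derivative by blast
qed (use that in blast)

lemma DERIV_at_continuous_on:
  fixes f :: "real \<Rightarrow> real"
  assumes "\<And>s. s \<in> I \<Longrightarrow> (f has_real_derivative f' s) (at s)"
  shows "continuous_on I f"
  using assms DERIV_isCont continuous_at_imp_continuous_on by blast

lemma zero_derivative_interval_const: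
  fixes f :: "real \<Rightarrow> real"
  assumes "is_interval I" and "\<And>s. s \<in> I \<Longrightarrow> (f has_real_derivative 0) (at s)"
  obtains c where "\<And>s. s \<in> I \<Longrightarrow> f s = c"
  using has_field_derivative_zero_constant[of I f] assms is_interval_convex
  by (metis has_field_derivative_at_within)

text \<open>
  Multiplying \<open>q\<close> by the integrating factor \<open>exp (- \<integral>B)\<close> gives a constant.
\<close>

lemma linear_ode_zero_or_nonzero:
  fixes q :: "real \<Rightarrow> real"
  assumes I: "open I" "is_interval I" and B: "continuous_on I B"
    and ode: "\<And>s. s \<in> I \<Longrightarrow> (q has_real_derivative B s * q s) (at s)"
  shows "(\<forall>s\<in>I. q s = 0) \<or> (\<forall>s\<in>I. q s \<noteq> 0)"
proof -
  obtain F where F: "\<And>s. s \<in> I \<Longrightarrow> (F has_real_derivative B s) (at s)"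
    using open_interval_antiderivative[OF I B] by blast
  have "((\<lambda>s. q s * exp (- F s)) has_real_derivative 0) (at s)" if "s \<in> I" for s
    by (auto intro!: derivative_eq_intros ode F that)
  then obtain c where "\<And>s. s \<in> I \<Longrightarrow> q s * exp (- F s) = c"
    using zero_derivative_interval_const[OF I(2)] by blast
  then show ?thesis by (metis exp_not_eq_zero mult_eq_0_iff)
qed

lemma nonzero_derivative_inj_open:
  fixes f :: "real \<Rightarrow> real"
  assumes I: "open I" "is_interval I"
    and f: "\<And>s. s \<in> I \<Longrightarrow> (f has_real_derivative f' s) (at s)"
    and nz: "\<And>s. s \<in> I \<Longrightarrow> f' s \<noteq> 0"
  shows "continuous_on I f" and "inj_on f I" and "open (f ` I)" and "is_interval (f ` I)"
proof -
  show cont: "continuous_on I f"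
    by (rule DERIV_at_continuous_on[OF f])
  show inj: "inj_on f I"
  proof (rule linorder_inj_onI)
    fix a b assume ab: "a < b" "a \<in> I" "b \<in> I"
    have sub: "{a..b} \<subseteq> I" using ab I(2) by (meson atLeastAtMost_iff is_interval_1 subsetI)
    then have "(f has_real_derivative f' t) (at t)" if "a \<le> t" "t \<le> b" for t
      using f that by auto
    from MVT2[OF \<open>a < b\<close> this] obtain c where "a < c" "c < b" "f b - f a = (b - a) * f' c"
      by blast
    moreover from this have "c \<in> I" using sub by auto
    then have "f' c \<noteq> 0" by (rule nz)
    ultimately show "f a \<noteq> f b" using ab(1) by auto
  qed auto
  show "open (f ` I)"
    using injective_into_1d_imp_open_map_UNIV[OF I(1) cont inj] by blast
  show "is_interval (f ` I)"
    using connected_continuous_image[OF cont] I(2) is_interval_connected_1 by blast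
qed

section \<open>Generatrices satisfying the cubic relation\<close>

text \<open>
  Three successive first integrals: \<open>1/q\<^sup>2 - \<mu>/x\<^sup>2\<close>, then \<open>x p / q - \<delta> z\<close>, then
  \<open>x\<^sup>2 - \<delta> z\<^sup>2 - 2 \<epsilon> z\<close>, where \<open>p = x'\<close> and \<open>q = z'\<close>. The second one is suggested by the expected
  result: differentiating \<open>x\<^sup>2 = \<delta> z\<^sup>2 + 2 \<epsilon> z + \<phi>\<close> gives \<open>x p = (\<delta> z + \<epsilon>) q\<close>.
\<close>

lemma cubic_relation_plane_or_quadric:
  assumes gen: "generatrix I x z"
    and rel: "\<forall>s\<in>I. k_m x z s = \<mu> * (k_p x z s)^3"
  shows "(\<forall>s\<in>I. deriv z s = 0) \<or>
    ((\<forall>s\<in>I. deriv z s \<noteq> 0) \<and>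
     (\<exists>\<delta> \<epsilon> \<phi>. \<epsilon>\<^sup>2 - \<delta> * \<phi> = \<mu> \<and> (\<forall>s\<in>I. (x s)\<^sup>2 = profile \<delta> \<epsilon> \<phi> (z s))))"
proof -
  define p where "p = deriv x"
  define q where "q = deriv z"
  define k where "k = (\<lambda>s. \<mu> * (q s / x s)^3)"
  have I: "open I" "is_interval I" "I \<noteq> {}"
    and unit: "\<And>s. s \<in> I \<Longrightarrow> (p s)\<^sup>2 + (q s)\<^sup>2 = 1"
    and pos: "\<And>s. s \<in> I \<Longrightarrow> x s > 0"
    and sm: "smooth_on I x" "smooth_on I z"
    using gen unfolding generatrix_def p_def q_def by auto
  have k: "k_m x z s = k s" if "s \<in> I" for s
    using rel that by (simp add: k_def k_p_def q_def)
  have x': "(x has_real_derivative p s) (at s)" if "s \<in> I" for s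
    using smooth_on_imp_derivs(1)[OF sm(1) that] by (simp add: p_def)
  have z': "(z has_real_derivative q s) (at s)" if "s \<in> I" for s
    using smooth_on_imp_derivs(1)[OF sm(2) that] by (simp add: q_def)
  have p': "(p has_real_derivative - q s * k s) (at s)" if "s \<in> I" for s
    using smooth_on_imp_derivs(2)[OF sm(1) that] generatrix_frenet(1)[OF gen that] k[OF that]
    by (simp add: p_def q_def)
  have q': "(q has_real_derivative p s * k s) (at s)" if "s \<in> I" for s
    using smooth_on_imp_derivs(2)[OF sm(2) that] generatrix_frenet(2)[OF gen that] k[OF that]
    by (simp add: p_def q_def)
  have cont: "continuous_on I x" "continuous_on I p" "continuous_on I q"
    by (rule DERIV_at_continuous_on, fact x' p' q')+
  have "(\<forall>s\<in>I. q s = 0) \<or> (\<forall>s\<in>I. q s \<noteq> 0)"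
  proof (rule linear_ode_zero_or_nonzero[OF I(1,2)])
    show "continuous_on I (\<lambda>s. \<mu> * p s * (q s)\<^sup>2 / (x s)^3)"
      using pos by (intro continuous_intros cont) force
    show "(q has_real_derivative \<mu> * p s * (q s)\<^sup>2 / (x s)^3 * q s) (at s)" if "s \<in> I" for s
      using q'[OF that] by (simp add: k_def power_divide power2_eq_square power3_eq_cube mult_ac)
  qed
  moreover have "\<exists>\<delta> \<epsilon> \<phi>. \<epsilon>\<^sup>2 - \<delta> * \<phi> = \<mu> \<and> (\<forall>s\<in>I. (x s)\<^sup>2 = profile \<delta> \<epsilon> \<phi> (z s))"
    if nz: "\<forall>s\<in>I. q s \<noteq> 0"
  proof -
    have "((\<lambda>s. 1 / (q s)\<^sup>2 - \<mu> / (x s)\<^sup>2) has_real_derivative 0) (at s)" if "s \<in> I" for s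
    proof -
      have "x s \<noteq> 0" "q s \<noteq> 0" using pos[OF that] nz that by auto
      then show ?thesis
        by (auto intro!: derivative_eq_intros x' q' that
            simp: k_def field_simps power2_eq_square power3_eq_cube)
    qed
    then obtain c where c: "\<And>s. s \<in> I \<Longrightarrow> 1 / (q s)\<^sup>2 - \<mu> / (x s)\<^sup>2 = c"
      using zero_derivative_interval_const[OF I(2)] by blast
    \<comment> \<open>Since \<open>p\<^sup>2 = 1 - q\<^sup>2\<close>, subtracting 1 turns this into \<open>p\<^sup>2/q\<^sup>2 = \<delta> + \<mu>/x\<^sup>2\<close>.\<close>
    define \<delta> where "\<delta> = c - 1"
    have first_integral: "(x s)\<^sup>2 = ((\<delta> + 1) * (x s)\<^sup>2 + \<mu>) * (q s)\<^sup>2" if "s \<in> I" for s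
      using c[OF that] pos[OF that] nz that by (simp add: \<delta>_def field_simps)
    have "((\<lambda>s. x s * p s / q s - \<delta> * z s) has_real_derivative 0) (at s)" if "s \<in> I" for s
    proof -
      have ne: "x s \<noteq> 0" "q s \<noteq> 0" using pos[OF that] nz that by auto
      have "(x s)\<^sup>2 * (q s)\<^sup>2 * k s * x s = \<mu> * (q s)^3 * (q s)\<^sup>2"
        using ne by (simp add: k_def field_simps power2_eq_square power3_eq_cube)
      then have "(x s)\<^sup>2 * (k s * x s) = (x s)\<^sup>2 * (q s * ((p s)\<^sup>2 - \<delta> * (q s)\<^sup>2))"
        using first_integral[OF that] unit[OF that] ne by algebra
      then have kx: "k s * x s = q s * ((p s)\<^sup>2 - \<delta> * (q s)\<^sup>2)" using ne by simp
      have "(((p s) * p s + x s * (- q s * k s)) * q s - x s * p s * (p s * k s)) / (q s * q s)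
          - \<delta> * q s = 0"
        using ne kx unit[OF that] by (simp add: divide_simps) algebra
      then show ?thesis
        using ne by (auto intro!: derivative_eq_intros x' p' q' z' that simp: algebra_simps)
    qed
    then obtain \<epsilon> where \<epsilon>: "\<And>s. s \<in> I \<Longrightarrow> x s * p s / q s - \<delta> * z s = \<epsilon>"
      using zero_derivative_interval_const[OF I(2)] by blast
    have w: "x s * p s = (\<delta> * z s + \<epsilon>) * q s" if "s \<in> I" for s
      using \<epsilon>[OF that] nz that by (simp add: field_simps)
    have "((\<lambda>s. (x s)\<^sup>2 - \<delta> * (z s)\<^sup>2 - 2 * \<epsilon> * z s) has_real_derivative 0) (at s)"
      if "s \<in> I" for s
      using w[OF that]
      by (auto intro!: derivative_eq_intros x' z' that simp: algebra_simps)
    then obtain \<phi> where \<phi>: "\<And>s. s \<in> I \<Longrightarrow> (x s)\<^sup>2 - \<delta> * (z s)\<^sup>2 - 2 * \<epsilon> * z s = \<phi>"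
      using zero_derivative_interval_const[OF I(2)] by blast
    have prof: "(x s)\<^sup>2 = profile \<delta> \<epsilon> \<phi> (z s)" if "s \<in> I" for s
      using \<phi>[OF that] by (simp add: profile_def)
    obtain s where s: "s \<in> I" using I(3) by blast
    have "(\<delta> * z s + \<epsilon>)\<^sup>2 * (q s)\<^sup>2 = (\<mu> + \<delta> * (x s)\<^sup>2) * (q s)\<^sup>2"
      using w[OF s] first_integral[OF s] unit[OF s] by algebra
    then have "(\<delta> * z s + \<epsilon>)\<^sup>2 = \<mu> + \<delta> * (x s)\<^sup>2" using nz s by simp
    then have "\<epsilon>\<^sup>2 - \<delta> * \<phi> = \<mu>"
      using profile_discriminant[of \<delta> "z s" \<epsilon> \<phi>] prof[OF s] by simp
    with prof show ?thesis by blast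
  qed
  ultimately show ?thesis unfolding q_def by blast
qed

section \<open>Rotational surfaces as parts of planes and quadrics\<close>

lemma polar_coordinates:
  fixes u v r :: real
  assumes "r > 0" "u\<^sup>2 + v\<^sup>2 = r\<^sup>2"
  obtains \<theta> where "u = r * cos \<theta>" "v = r * sin \<theta>"
proof -
  have "(u / r)\<^sup>2 + (v / r)\<^sup>2 = 1" using assms by (simp add: field_simps)
  then obtain \<theta> where "u / r = cos \<theta>" "v / r = sin \<theta>" using sincos_total_2pi by blast
  then show ?thesis using that[of \<theta>] assms(1) by (simp add: field_simps)
qed

lemma circle_points:
  "vector [r * cos \<theta>, r * sin \<theta>, t] \<in> quadric \<delta> \<epsilon> \<phi> \<longleftrightarrow> r\<^sup>2 = profile \<delta> \<epsilon> \<phi> t"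
proof -
  have "(r * cos \<theta>)\<^sup>2 + (r * sin \<theta>)\<^sup>2 = r\<^sup>2 * ((cos \<theta>)\<^sup>2 + (sin \<theta>)\<^sup>2)"
    by (simp add: power_mult_distrib algebra_simps del: sin_cos_squared_add sin_cos_squared_add2)
  then show ?thesis by (simp add: quadric_def vector_3)
qed

text \<open>
  The equation of the quadric determines the radius from the height, so a rotational surface inside
  it is cut out by the condition on the height alone.
\<close>

lemma rotational_surface_eq_slab:
  assumes "\<And>s. s \<in> I \<Longrightarrow> x s > 0" "\<And>s. s \<in> I \<Longrightarrow> (x s)\<^sup>2 = profile \<delta> \<epsilon> \<phi> (z s)"
  shows "rotational_surface I x z = {p \<in> quadric \<delta> \<epsilon> \<phi>. p$3 \<in> z ` I}"
proof (intro set_eqI iffI)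
  fix p assume "p \<in> rotational_surface I x z"
  then show "p \<in> {p \<in> quadric \<delta> \<epsilon> \<phi>. p$3 \<in> z ` I}"
    unfolding rotational_surface_def using assms(2) by (auto simp: circle_points vector_3)
next
  fix p assume "p \<in> {p \<in> quadric \<delta> \<epsilon> \<phi>. p$3 \<in> z ` I}"
  then obtain s where s: "s \<in> I" "p$3 = z s" "(p$1)\<^sup>2 + (p$2)\<^sup>2 = (x s)\<^sup>2"
    unfolding quadric_def using assms(2) by auto
  then obtain \<theta> where "p$1 = x s * cos \<theta>" "p$2 = x s * sin \<theta>"
    using polar_coordinates assms(1) by metis
  with s have "p = vector [x s * cos \<theta>, x s * sin \<theta>, z s]" by (simp add: vec3_eq_iff vector_3)
  with s(1) show "p \<in> rotational_surface I x z" unfolding rotational_surface_def by blast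
qed

lemma rotational_surface_horizontal:
  assumes "\<And>s. s \<in> I \<Longrightarrow> x s > 0" "\<And>s. s \<in> I \<Longrightarrow> z s = h"
  shows "rotational_surface I x z = {p. p$3 = h \<and> sqrt ((p$1)\<^sup>2 + (p$2)\<^sup>2) \<in> x ` I}"
proof (intro set_eqI iffI)
  fix p assume "p \<in> rotational_surface I x z"
  then obtain s \<theta> where s: "s \<in> I" "p = vector [x s * cos \<theta>, x s * sin \<theta>, h]"
    unfolding rotational_surface_def using assms(2) by auto
  have "(x s * cos \<theta>)\<^sup>2 + (x s * sin \<theta>)\<^sup>2 = (x s)\<^sup>2 * ((cos \<theta>)\<^sup>2 + (sin \<theta>)\<^sup>2)"
    by (simp add: power_mult_distrib algebra_simps del: sin_cos_squared_add sin_cos_squared_add2)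
  then show "p \<in> {p. p$3 = h \<and> sqrt ((p$1)\<^sup>2 + (p$2)\<^sup>2) \<in> x ` I}"
    using s assms(1)[OF s(1)] by (simp add: vector_3)
next
  fix p :: "real^3" assume p: "p \<in> {p. p$3 = h \<and> sqrt ((p$1)\<^sup>2 + (p$2)\<^sup>2) \<in> x ` I}"
  then obtain s where s: "s \<in> I" "sqrt ((p$1)\<^sup>2 + (p$2)\<^sup>2) = x s" by auto
  then have "(p$1)\<^sup>2 + (p$2)\<^sup>2 = (x s)\<^sup>2"
    by (metis real_sqrt_pow2 sum_power2_ge_zero)
  then obtain \<theta> where "p$1 = x s * cos \<theta>" "p$2 = x s * sin \<theta>"
    using polar_coordinates assms(1)[OF s(1)] by metis
  with p s have "p = vector [x s * cos \<theta>, x s * sin \<theta>, z s]"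
    using assms(2) by (simp add: vec3_eq_iff vector_3)
  with s(1) show "p \<in> rotational_surface I x z" unfolding rotational_surface_def by blast
qed

text \<open>
  On a plane the radius, and on a quadric the height, has nowhere vanishing derivative along the
  generatrix. So it takes an open set of values, and the surface is the preimage of that set.
\<close>

lemma cubic_relation_imp_open_piece:
  assumes gen: "generatrix I x z" and "\<mu> \<noteq> 0"
    and rel: "\<forall>s\<in>I. k_m x z s = \<mu> * (k_p x z s)^3"
  shows "\<exists>Q. (horizontal_plane Q \<or> nondegenerate_quadric_of_revolution Q) \<and>
           openin (top_of_set Q) (rotational_surface I x z)"
proof -
  have I: "open I" "is_interval I" "I \<noteq> {}" and pos: "\<And>s. s \<in> I \<Longrightarrow> x s > 0"
    and unit: "\<And>s. s \<in> I \<Longrightarrow> (deriv x s)\<^sup>2 + (deriv z s)\<^sup>2 = 1"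
    and sm: "smooth_on I x" "smooth_on I z"
    using gen unfolding generatrix_def by auto
  from cubic_relation_plane_or_quadric[OF gen rel] show ?thesis
  proof (elim disjE conjE exE)
    assume flat: "\<forall>s\<in>I. deriv z s = 0"
    then have "(z has_real_derivative 0) (at s)" if "s \<in> I" for s
      using smooth_on_imp_derivs(1)[OF sm(2) that] that by simp
    then obtain h where h: "\<And>s. s \<in> I \<Longrightarrow> z s = h"
      using zero_derivative_interval_const[OF I(2)] by blast
    have "deriv x s \<noteq> 0" if "s \<in> I" for s
      using unit[OF that] flat that by auto
    then have "open (x ` I)"
      using nonzero_derivative_inj_open(3)[OF I(1,2) smooth_on_imp_derivs(1)[OF sm(1)]] by blast
    then have "open ((\<lambda>p :: real^3. sqrt ((p$1)\<^sup>2 + (p$2)\<^sup>2)) -` (x ` I))"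
      by (intro open_vimage continuous_intros)
    moreover have "rotational_surface I x z =
        {p. p$3 = h} \<inter> (\<lambda>p :: real^3. sqrt ((p$1)\<^sup>2 + (p$2)\<^sup>2)) -` (x ` I)"
      using rotational_surface_horizontal[of I x z h] pos h by auto
    ultimately have "openin (top_of_set {p. p$3 = h}) (rotational_surface I x z)"
      by (simp add: openin_open_Int)
    then show ?thesis unfolding horizontal_plane_def by blast
  next
    fix \<delta> \<epsilon> \<phi>
    assume nz: "\<forall>s\<in>I. deriv z s \<noteq> 0" and mu: "\<epsilon>\<^sup>2 - \<delta> * \<phi> = \<mu>"
      and prof: "\<forall>s\<in>I. (x s)\<^sup>2 = profile \<delta> \<epsilon> \<phi> (z s)"
    have slab: "rotational_surface I x z = {p \<in> quadric \<delta> \<epsilon> \<phi>. p$3 \<in> z ` I}"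
      using rotational_surface_eq_slab pos prof by blast
    have "open (z ` I)"
      using nonzero_derivative_inj_open(3)[OF I(1,2) smooth_on_imp_derivs(1)[OF sm(2)]] nz by blast
    then have "open ((\<lambda>p :: real^3. p$3) -` (z ` I))"
      by (intro open_vimage continuous_intros)
    then have "openin (top_of_set (quadric \<delta> \<epsilon> \<phi>)) (rotational_surface I x z)"
      unfolding slab by (auto simp: openin_open)
    moreover have "rotational_surface I x z \<noteq> {}"
      using I(3) unfolding rotational_surface_def by auto
    then have "nondegenerate_quadric_of_revolution (quadric \<delta> \<epsilon> \<phi>)"
      using quadric_imp_nondegenerate mu \<open>\<mu> \<noteq> 0\<close> unfolding slab by blast
    ultimately show ?thesis by blast
  qed
qed

section \<open>Generatrices of quadrics\<close>

text \<open>
  With \<open>w = \<delta> z + \<epsilon>\<close>, the first derivative of the equation is \<open>x x' = w z'\<close>. Inserting Frenet's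
  formulas into the second one and eliminating \<open>w\<close> gives
  \<open>k\<^sub>m x = z' (x'\<^sup>2 - \<delta> z'\<^sup>2)\<close>; the discriminant identity then turns the right-hand side into
  \<open>\<mu> z'\<^sup>3 / x\<^sup>2\<close>.
\<close>

lemma cubic_relation_on_quadric:
  assumes gen: "generatrix I x z" and "s \<in> I"
    and prof: "\<And>s. s \<in> I \<Longrightarrow> (x s)\<^sup>2 = profile \<delta> \<epsilon> \<phi> (z s)"
  shows "k_m x z s = (\<epsilon>\<^sup>2 - \<delta> * \<phi>) * (k_p x z s)^3"
proof -
  define k where "k = k_m x z s"
  define w where "w = (\<lambda>s. \<delta> * z s + \<epsilon>)"
  have I: "open I" and pos: "x s > 0" and unit: "(deriv x s)\<^sup>2 + (deriv z s)\<^sup>2 = 1"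
    and sm: "smooth_on I x" "smooth_on I z"
    using gen \<open>s \<in> I\<close> unfolding generatrix_def by auto
  note D = smooth_on_imp_derivs[OF sm(1)] smooth_on_imp_derivs[OF sm(2)]
  have first: "x s * deriv x s = w s * deriv z s" if "s \<in> I" for s
  proof -
    have "((\<lambda>s. (x s)\<^sup>2) has_real_derivative 2 * (x s * deriv x s)) (at s)"
      by (auto intro!: derivative_eq_intros D that)
    moreover have "((\<lambda>s. profile \<delta> \<epsilon> \<phi> (z s)) has_real_derivative 2 * w s * deriv z s) (at s)"
      using DERIV_chain2[OF profile_has_derivative D(3)[OF that]] by (simp add: w_def)
    then have "((\<lambda>s. (x s)\<^sup>2) has_real_derivative 2 * w s * deriv z s) (at s)"
      by (rule has_field_derivative_transform_within_open[OF _ I that]) (simp add: prof)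
    ultimately show ?thesis using DERIV_unique by fastforce
  qed
  have "((\<lambda>s. x s * deriv x s) has_real_derivative
      deriv x s * deriv x s + deriv (deriv x) s * x s) (at s)"
    by (rule DERIV_mult) (auto intro: D \<open>s \<in> I\<close>)
  moreover have "((\<lambda>s. w s * deriv z s) has_real_derivative
      \<delta> * deriv z s * deriv z s + deriv (deriv z) s * w s) (at s)"
    unfolding w_def by (auto intro!: derivative_eq_intros D \<open>s \<in> I\<close>)
  then have "((\<lambda>s. x s * deriv x s) has_real_derivative
      \<delta> * deriv z s * deriv z s + deriv (deriv z) s * w s) (at s)"
    by (rule has_field_derivative_transform_within_open[OF _ I \<open>s \<in> I\<close>]) (simp add: first)
  ultimately have second: "deriv x s * deriv x s + deriv (deriv x) s * x s
      = \<delta> * deriv z s * deriv z s + deriv (deriv z) s * w s"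
    by (rule DERIV_unique)
  have sec: "(deriv x s)\<^sup>2 - deriv z s * k * x s = \<delta> * (deriv z s)\<^sup>2 + deriv x s * k * w s"
    using second generatrix_frenet[OF gen \<open>s \<in> I\<close>] by (simp add: k_def power2_eq_square mult_ac)
  have disc: "(w s)\<^sup>2 = \<epsilon>\<^sup>2 - \<delta> * \<phi> + \<delta> * (x s)\<^sup>2"
    using profile_discriminant[of \<delta> "z s" \<epsilon> \<phi>] prof[OF \<open>s \<in> I\<close>] by (simp add: w_def)
  have kx: "k * x s = deriv z s * ((deriv x s)\<^sup>2 - \<delta> * (deriv z s)\<^sup>2)"
    using sec first[OF \<open>s \<in> I\<close>] unit by algebra
  have "k * (x s)^3 = (\<epsilon>\<^sup>2 - \<delta> * \<phi>) * (deriv z s)^3"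
    using kx first[OF \<open>s \<in> I\<close>] disc by algebra
  then show ?thesis using pos by (simp add: k_def k_p_def field_simps)
qed

text \<open>
  With \<open>P\<close> the profile and \<open>w = P'/2\<close>, the profile curve \<open>x = sqrt P\<close>, as a graph over the height
  \<open>t\<close>, has slope \<open>w / sqrt P\<close> and thus arc length element \<open>sqrt ((w\<^sup>2 + P) / P) dt\<close>. Its
  antiderivative \<open>L\<close> is inverted to give the height \<open>z\<close> as a function of arc length. The length may
  be finite or infinite at either end; in each case the image of \<open>L\<close> is an open interval.

  Smoothness comes without a theory of smooth inverses: with \<open>n = 1 / sqrt (w\<^sup>2 + x\<^sup>2)\<close>, the functions
  \<open>x\<close>, \<open>z\<close>, \<open>n\<close> solve the polynomial system \<open>x' = w n\<close>, \<open>z' = x n\<close>, \<open>n' = - (\<delta> + 1) w x n\<^sup>4\<close>, where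
  \<open>w = \<delta> z + \<epsilon>\<close>.
\<close>

lemma generatrix_over_interval:
  assumes J: "open J" "is_interval J" "J \<noteq> {}"
    and P: "\<And>t. t \<in> J \<Longrightarrow> profile \<delta> \<epsilon> \<phi> t > 0"
  obtains I x z where "generatrix I x z" "z ` I = J"
    "\<And>s. s \<in> I \<Longrightarrow> (x s)\<^sup>2 = profile \<delta> \<epsilon> \<phi> (z s)"
proof -
  define w where "w = (\<lambda>t. \<delta> * t + \<epsilon>)"
  define P where "P = profile \<delta> \<epsilon> \<phi>"
  define N where "N = (\<lambda>t. (w t)\<^sup>2 + P t)"
  have Ppos: "P t > 0" if "t \<in> J" for t using P[OF that] by (simp add: P_def)
  have Npos: "N t > 0" if "t \<in> J" for t
    using Ppos[OF that] by (simp add: N_def add_nonneg_pos)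
  have P': "(P has_real_derivative 2 * w t) (at t)" for t
    unfolding P_def w_def by (rule profile_has_derivative)
  have N': "(N has_real_derivative 2 * (\<delta> + 1) * w t) (at t)" for t
    unfolding N_def w_def
    by (auto intro!: derivative_eq_intros P'[unfolded w_def] simp: algebra_simps)
  have cont: "continuous_on J P" "continuous_on J N"
    by (rule DERIV_at_continuous_on, rule P' N')+
  have "continuous_on J (\<lambda>t. sqrt (N t) / sqrt (P t))"
    using Ppos by (intro continuous_intros cont) force
  then obtain L where L: "\<And>t. t \<in> J \<Longrightarrow> (L has_real_derivative sqrt (N t) / sqrt (P t)) (at t)"
    using open_interval_antiderivative[OF J(1,2)] by blast
  have nz: "sqrt (N t) / sqrt (P t) \<noteq> 0" if "t \<in> J" for t
    using Ppos[OF that] Npos[OF that] by simp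
  define I where "I = L ` J"
  define z where "z = the_inv_into J L"
  define x where "x = (\<lambda>s. sqrt (P (z s)))"
  define n where "n = (\<lambda>s. 1 / sqrt (N (z s)))"
  note Lprops = nonzero_derivative_inj_open[OF J(1,2) L nz]
  have I: "open I" "is_interval I" "I \<noteq> {}" using Lprops J(3) by (auto simp: I_def)
  have zL: "z (L t) = t" if "t \<in> J" for t
    using the_inv_into_f_f[OF Lprops(2) that] by (simp add: z_def)
  have zI: "z s \<in> J" if "s \<in> I" for s using that zL by (auto simp: I_def)
  have zimg: "z ` I = J" using zL by (force simp: I_def image_image)
  have z': "(z has_real_derivative x s * n s) (at s)" if "s \<in> I" for s
  proof -
    obtain t where t: "t \<in> J" "s = L t" using \<open>s \<in> I\<close> by (auto simp: I_def)
    have "(z has_derivative (*) (sqrt (P t) / sqrt (N t))) (at (L t))"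
    proof (rule has_derivative_inverse_strong[OF J(1) t(1) Lprops(1) zL])
      show "(L has_derivative (*) (sqrt (N t) / sqrt (P t))) (at t)"
        using L[OF t(1)] by (simp add: has_field_derivative_def)
      show "(*) (sqrt (N t) / sqrt (P t)) \<circ> (*) (sqrt (P t) / sqrt (N t)) = id"
        using Ppos[OF t(1)] Npos[OF t(1)] by (auto simp: fun_eq_iff)
    qed
    then show ?thesis
      unfolding t(2) by (simp add: has_field_derivative_def x_def n_def zL[OF t(1)])
  qed
  have xpos: "x s > 0" if "s \<in> I" for s using Ppos[OF zI[OF that]] by (simp add: x_def)
  have npos: "n s > 0" if "s \<in> I" for s using Npos[OF zI[OF that]] by (simp add: n_def)
  have x2: "(x s)\<^sup>2 = P (z s)" if "s \<in> I" for s using Ppos[OF zI[OF that]] by (simp add: x_def)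
  have n2: "(n s)\<^sup>2 * ((w (z s))\<^sup>2 + (x s)\<^sup>2) = 1" if "s \<in> I" for s
  proof -
    have "N (z s) = (w (z s))\<^sup>2 + (x s)\<^sup>2" using x2[OF that] by (simp add: N_def)
    moreover have "(n s)\<^sup>2 * N (z s) = 1"
      using Npos[OF zI[OF that]] by (simp add: n_def power_divide)
    ultimately show ?thesis by simp
  qed
  have x': "(x has_real_derivative w (z s) * n s) (at s)" if "s \<in> I" for s
  proof -
    have "((\<lambda>s. sqrt (P (z s))) has_real_derivative
        (inverse (sqrt (P (z s))) / 2) * (2 * w (z s) * (x s * n s))) (at s)"
      by (rule DERIV_chain2[OF DERIV_real_sqrt DERIV_chain2[OF P' z'[OF that]]])
        (rule Ppos[OF zI[OF that]])
    moreover have "sqrt (P (z s)) = x s" by (simp add: x_def)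
    ultimately show ?thesis using xpos[OF that] by (simp add: x_def[symmetric] field_simps)
  qed
  have n': "(n has_real_derivative - (\<delta> + 1) * w (z s) * x s * (n s)^4) (at s)" if "s \<in> I" for s
  proof -
    define r where "r = sqrt (N (z s))"
    have r: "r > 0" "n s = 1 / r" using Npos[OF zI[OF that]] by (auto simp: r_def n_def)
    have d: "((\<lambda>s. sqrt (N (z s))) has_real_derivative
        (inverse r / 2) * (2 * (\<delta> + 1) * w (z s) * (x s * n s))) (at s)"
      unfolding r_def
      by (rule DERIV_chain2[OF DERIV_real_sqrt DERIV_chain2[OF N' z'[OF that]]])
        (rule Npos[OF zI[OF that]])
    have "n = (\<lambda>s. inverse (sqrt (N (z s))))" by (simp add: n_def inverse_eq_divide)
    then have "(n has_real_derivative
        - (inverse r * ((inverse r / 2) * (2 * (\<delta> + 1) * w (z s) * (x s * n s))) * inverse r)) (at s)"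
      using DERIV_inverse'[OF d] r(1) by (simp add: r_def[symmetric])
    moreover have
      "- (inverse r * ((inverse r / 2) * (2 * (\<delta> + 1) * w (z s) * (x s * n s))) * inverse r)
        = - (\<delta> + 1) * w (z s) * x s * (n s)^4"
      unfolding r(2) using r(1) by (simp add: field_simps power4_eq_xxxx)
    ultimately show ?thesis by (simp only:)
  qed
  let ?G = "{x, z, n}"
  have "smooth_on I f" if "f \<in> ?G" for f
  proof (rule smooth_on_polynomial_system[OF I(1) that])
    have alg: "x \<in> poly_algebra ?G" "z \<in> poly_algebra ?G" "n \<in> poly_algebra ?G"
      by (auto intro: poly_algebra.gen)
    note const = poly_algebra.const and add = poly_algebra.add and mult = poly_algebra.mult
    have walg: "(\<lambda>s. w (z s)) \<in> poly_algebra ?G"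
      unfolding w_def by (rule add[OF mult[OF const alg(2)] const])
    have xalg: "(\<lambda>s. w (z s) * n s) \<in> poly_algebra ?G"
      by (rule mult[OF walg alg(3)])
    have zalg: "(\<lambda>s. x s * n s) \<in> poly_algebra ?G"
      by (rule mult[OF alg(1,3)])
    have "(\<lambda>s. - (\<delta> + 1) * w (z s) * x s * (n s * n s * n s * n s)) \<in> poly_algebra ?G"
      by (rule mult[OF mult[OF mult[OF const walg] alg(1)]
            mult[OF mult[OF mult[OF alg(3,3)] alg(3)] alg(3)]])
    then have nalg: "(\<lambda>s. - (\<delta> + 1) * w (z s) * x s * (n s)^4) \<in> poly_algebra ?G"
      by (simp only: power4_eq_xxxx)
    fix g assume "g \<in> ?G"
    then consider "g = x" | "g = z" | "g = n" by blast
    then show "\<exists>g'\<in>poly_algebra ?G. \<forall>s\<in>I. (g has_real_derivative g' s) (at s)"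
    proof cases
      case 1
      show ?thesis unfolding 1 by (rule bexI[OF _ xalg]) (rule ballI, rule x')
    next
      case 2
      show ?thesis unfolding 2 by (rule bexI[OF _ zalg]) (rule ballI, rule z')
    next
      case 3
      show ?thesis unfolding 3 by (rule bexI[OF _ nalg]) (rule ballI, rule n')
    qed
  qed
  then have "smooth_on I x" "smooth_on I z" by auto
  moreover have "(deriv x s)\<^sup>2 + (deriv z s)\<^sup>2 = 1" if "s \<in> I" for s
    using DERIV_imp_deriv[OF x'[OF that]] DERIV_imp_deriv[OF z'[OF that]] n2[OF that]
    by (simp add: power_mult_distrib algebra_simps)
  ultimately have "generatrix I x z"
    unfolding generatrix_def using I xpos by blast
  then show ?thesis using that zimg x2 by (simp add: P_def)
qed

section \<open>Components of quadrics\<close>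

lemma connected_slab:
  assumes "is_interval K" "\<And>t. t \<in> K \<Longrightarrow> profile \<delta> \<epsilon> \<phi> t \<ge> 0"
  shows "connected {p \<in> quadric \<delta> \<epsilon> \<phi>. p$3 \<in> K}"
proof -
  let ?X = "\<lambda>(t, \<theta>). vector [sqrt (profile \<delta> \<epsilon> \<phi> t) * cos \<theta>, sqrt (profile \<delta> \<epsilon> \<phi> t) * sin \<theta>, t]
    :: real^3"
  have image: "{p \<in> quadric \<delta> \<epsilon> \<phi>. p$3 \<in> K} = ?X ` (K \<times> UNIV)"
  proof (intro set_eqI iffI)
    fix p assume p: "p \<in> {p \<in> quadric \<delta> \<epsilon> \<phi>. p$3 \<in> K}"
    define r where "r = sqrt (profile \<delta> \<epsilon> \<phi> (p$3))"
    have r: "r \<ge> 0" "(p$1)\<^sup>2 + (p$2)\<^sup>2 = r\<^sup>2" using p assms(2) by (auto simp: r_def quadric_def)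
    have "\<exists>\<theta>. p$1 = r * cos \<theta> \<and> p$2 = r * sin \<theta>"
    proof (cases "r = 0")
      case True
      then show ?thesis using r(2) by (simp add: sum_power2_eq_zero_iff)
    next
      case False
      then have "r > 0" using r(1) by simp
      from polar_coordinates[OF this r(2)] show ?thesis by metis
    qed
    then obtain \<theta> where "p$1 = r * cos \<theta>" "p$2 = r * sin \<theta>" by blast
    then have "p = ?X (p$3, \<theta>)"
      unfolding r_def split_conv vec3_eq_iff vector_3 by blast
    then show "p \<in> ?X ` (K \<times> UNIV)" by (rule image_eqI) (use p in simp)
  next
    fix p assume "p \<in> ?X ` (K \<times> UNIV)"
    then show "p \<in> {p \<in> quadric \<delta> \<epsilon> \<phi>. p$3 \<in> K}"
      using assms(2) by (auto simp: circle_points vector_3)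
  qed
  have cont: "continuous_on (K \<times> UNIV) ?X"
  proof -
    have "?X = (\<lambda>u. \<chi> i. if i = 1 then sqrt (profile \<delta> \<epsilon> \<phi> (fst u)) * cos (snd u)
        else if i = 2 then sqrt (profile \<delta> \<epsilon> \<phi> (fst u)) * sin (snd u) else fst u)"
      unfolding fun_eq_iff vec3_eq_iff case_prod_beta vector_3 by simp
    moreover have "continuous_on (K \<times> UNIV) \<dots>"
    proof (rule continuous_on_vec_lambda)
      fix i :: 3
      show "continuous_on (K \<times> UNIV) (\<lambda>u. if i = 1 then sqrt (profile \<delta> \<epsilon> \<phi> (fst u)) * cos (snd u)
        else if i = 2 then sqrt (profile \<delta> \<epsilon> \<phi> (fst u)) * sin (snd u) else fst u)"
        unfolding profile_def by (cases "i = 1"; cases "i = 2") (auto intro!: continuous_intros)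
    qed
    ultimately show ?thesis by simp
  qed
  have "connected (K \<times> (UNIV :: real set))"
    using connected_Times[of K UNIV] assms(1) is_interval_connected connected_UNIV by blast
  then show ?thesis unfolding image by (rule connected_continuous_image[OF cont])
qed

text \<open>
  The heights \<open>K\<close> of a component form an interval on which the profile is nonnegative. It is a
  maximal one, because the part of the quadric over a larger interval of this kind would be connected
  (\<open>absorb\<close>). Points on the axis lie at the zeros of the profile, which are simple: at such a zero the
  profile changes sign, so it cannot lie inside \<open>K\<close>; and the profile is positive on one side of it,
  so \<open>K\<close> does not reduce to that point.
\<close>

lemma component_off_axis_slab:
  assumes disc: "\<epsilon>\<^sup>2 - \<delta> * \<phi> \<noteq> 0" and C: "C \<in> components (quadric \<delta> \<epsilon> \<phi>)"
  obtains J where "open J" "is_interval J" "J \<noteq> {}"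
    "\<And>t. t \<in> J \<Longrightarrow> profile \<delta> \<epsilon> \<phi> t > 0"
    "C - z_axis = {p \<in> quadric \<delta> \<epsilon> \<phi>. p$3 \<in> J}"
proof -
  define P where "P = profile \<delta> \<epsilon> \<phi>"
  define K where "K = (\<lambda>p :: real^3. p$3) ` C"
  define J where "J = {t \<in> K. P t > 0}"
  have Csub: "C \<subseteq> quadric \<delta> \<epsilon> \<phi>" and "C \<noteq> {}" and "connected C"
    using C in_components_subset in_components_nonempty in_components_connected by auto
  have Knn: "P t \<ge> 0" if "t \<in> K" for t
  proof -
    obtain p where "p \<in> C" "t = p$3" using \<open>t \<in> K\<close> by (auto simp: K_def)
    then have "P t = (p$1)\<^sup>2 + (p$2)\<^sup>2" using Csub by (auto simp: quadric_def P_def)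
    then show ?thesis by simp
  qed
  have "connected K"
    unfolding K_def using \<open>connected C\<close>
    by (intro connected_continuous_image continuous_intros)
  then have K: "is_interval K" by (simp add: is_interval_connected_1)
  have absorb: "{p \<in> quadric \<delta> \<epsilon> \<phi>. p$3 \<in> M} \<subseteq> C \<and> M \<subseteq> K"
    if M: "is_interval M" "\<And>t. t \<in> M \<Longrightarrow> P t \<ge> 0" "M \<inter> K \<noteq> {}" for M
  proof -
    have "connected {p \<in> quadric \<delta> \<epsilon> \<phi>. p$3 \<in> M}"
      using connected_slab M(1,2) by (simp add: P_def)
    moreover have "C \<inter> {p \<in> quadric \<delta> \<epsilon> \<phi>. p$3 \<in> M} \<noteq> {}"
      using M(3) Csub unfolding K_def by blast
    ultimately have sub: "{p \<in> quadric \<delta> \<epsilon> \<phi>. p$3 \<in> M} \<subseteq> C"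
      using components_maximal[OF C] by blast
    moreover have "M \<subseteq> K"
    proof
      fix t assume "t \<in> M"
      then have "vector [sqrt (P t) * cos 0, sqrt (P t) * sin 0, t] \<in> {p \<in> quadric \<delta> \<epsilon> \<phi>. p$3 \<in> M}"
        using M(2) by (simp only: mem_Collect_eq circle_points vector_3) (simp add: P_def)
      then show "t \<in> K" using sub unfolding K_def by (force simp: vector_3)
    qed
    ultimately show ?thesis by blast
  qed
  have "K \<noteq> {}" using \<open>C \<noteq> {}\<close> by (simp add: K_def)
  have Cslab: "C = {p \<in> quadric \<delta> \<epsilon> \<phi>. p$3 \<in> K}"
    using absorb[OF K Knn] \<open>K \<noteq> {}\<close> Csub by (auto simp: K_def)
  have P': "(P has_real_derivative 2 * (\<delta> * t + \<epsilon>)) (at t)" for t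
    unfolding P_def by (rule profile_has_derivative)
  have simple: "2 * (\<delta> * t + \<epsilon>) \<noteq> 0" if "P t = 0" for t
  proof -
    have "(\<delta> * t + \<epsilon>)\<^sup>2 \<noteq> 0"
      using profile_discriminant[of \<delta> t \<epsilon> \<phi>] that disc by (simp add: P_def)
    then show ?thesis by (simp del: distrib_left_numeral)
  qed
  have contP: "continuous_on UNIV P"
    by (rule DERIV_at_continuous_on[OF P'])
  \<comment> \<open>Near a height with positive profile the profile stays positive, so \<open>K\<close> absorbs a ball.\<close>
  have "open J"
  proof (rule openI)
    fix t assume "t \<in> J"
    then have "t \<in> {t. P t > 0}" by (simp add: J_def)
    moreover have "open {t. P t > 0}"
      using contP by (intro open_Collect_less continuous_intros)
    ultimately obtain e where e: "e > 0" "ball t e \<subseteq> {t. P t > 0}" by (meson openE)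
    have "ball t e \<subseteq> K"
    proof -
      have "is_interval (ball t e)" by (simp add: is_interval_connected_1)
      moreover have "P u \<ge> 0" if "u \<in> ball t e" for u using e(2) that by fastforce
      moreover have "t \<in> ball t e \<inter> K" using e(1) \<open>t \<in> J\<close> by (simp add: J_def)
      ultimately show ?thesis using absorb by blast
    qed
    with e show "\<exists>e>0. ball t e \<subseteq> J" by (auto simp: J_def)
  qed
  moreover have "is_interval J"
    unfolding is_interval_1
  proof (intro ballI allI impI)
    fix a b t assume ab: "a \<in> J" "b \<in> J" "a \<le> t \<and> t \<le> b"
    have between: "u \<in> K" if "a \<le> u" "u \<le> b" for u
      using K ab(1,2) that unfolding is_interval_1 J_def by blast
    have "P t \<noteq> 0"
    proof
      assume "P t = 0"
      then have "a < t" "t < b" using ab by (auto simp: J_def order.order_iff_strict)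
      \<comment> \<open>An interior zero would be a local minimum of the profile.\<close>
      have "\<forall>u. \<bar>t - u\<bar> < min (t - a) (b - t) \<longrightarrow> P t \<le> P u"
        using between Knn \<open>P t = 0\<close> by (auto simp: abs_less_iff)
      then have "2 * (\<delta> * t + \<epsilon>) = 0"
        using DERIV_local_min[OF P', of "min (t - a) (b - t)" t] \<open>a < t\<close> \<open>t < b\<close> by auto
      with simple[OF \<open>P t = 0\<close>] show False by simp
    qed
    moreover have "t \<in> K" using between ab(3) by blast
    ultimately show "t \<in> J" using Knn[of t] by (simp add: J_def)
  qed
  moreover have "J \<noteq> {}"
  proof
    assume "J = {}"
    obtain t where "t \<in> K" using \<open>K \<noteq> {}\<close> by blast
    then have "P t = 0" using Knn[OF \<open>t \<in> K\<close>] \<open>J = {}\<close> by (auto simp: J_def)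
    from simple[OF this] consider "2 * (\<delta> * t + \<epsilon>) > 0" | "2 * (\<delta> * t + \<epsilon>) < 0" by linarith
    then show False
    proof cases
      case 1
      then obtain d where d: "d > 0" "\<forall>h>0. h < d \<longrightarrow> P t < P (t + h)"
        using DERIV_pos_inc_right[OF P'] by blast
      have up: "P u > 0" if "t < u" "u < t + d" for u
        using d(2)[rule_format, of "u - t"] that \<open>P t = 0\<close> by simp
      have "{t..<t + d} \<subseteq> K"
      proof -
        have "P u \<ge> 0" if "u \<in> {t..<t + d}" for u
          using up[of u] that \<open>P t = 0\<close> by (cases "u = t") auto
        moreover have "t \<in> {t..<t + d} \<inter> K" using \<open>t \<in> K\<close> d(1) by simp
        ultimately show ?thesis using absorb is_interval_co by blast
      qed
      then have "t + d / 2 \<in> J" using up d(1) by (auto simp: J_def)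
      with \<open>J = {}\<close> show False by simp
    next
      case 2
      then obtain d where d: "d > 0" "\<forall>h>0. h < d \<longrightarrow> P t < P (t - h)"
        using DERIV_neg_dec_left[OF P'] by blast
      have up: "P u > 0" if "t - d < u" "u < t" for u
        using d(2)[rule_format, of "t - u"] that \<open>P t = 0\<close> by simp
      have "{t - d<..t} \<subseteq> K"
      proof -
        have "P u \<ge> 0" if "u \<in> {t - d<..t}" for u
          using up[of u] that \<open>P t = 0\<close> by (cases "u = t") auto
        moreover have "t \<in> {t - d<..t} \<inter> K" using \<open>t \<in> K\<close> d(1) by simp
        ultimately show ?thesis using absorb is_interval_oc by blast
      qed
      then have "t - d / 2 \<in> J" using up d(1) by (auto simp: J_def)
      with \<open>J = {}\<close> show False by simp
    qed
  qed
  moreover have "C - z_axis = {p \<in> quadric \<delta> \<epsilon> \<phi>. p$3 \<in> J}"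
  proof -
    have "p \<notin> z_axis \<longleftrightarrow> P (p$3) > 0" if "p \<in> quadric \<delta> \<epsilon> \<phi>" for p
    proof -
      have "P (p$3) = (p$1)\<^sup>2 + (p$2)\<^sup>2" using that by (simp add: quadric_def P_def)
      then show ?thesis by (simp add: z_axis_def sum_power2_gt_zero_iff)
    qed
    then show ?thesis unfolding J_def by (subst Cslab) auto
  qed
  ultimately show ?thesis using that by (auto simp: J_def P_def)
qed

section \<open>Planes and quadrics satisfy the cubic relation\<close>

lemma quadric_satisfies_cubic_relation:
  assumes "\<epsilon>\<^sup>2 - \<delta> * \<phi> \<noteq> 0"
  shows "satisfies_cubic_relation (\<epsilon>\<^sup>2 - \<delta> * \<phi>) (quadric \<delta> \<epsilon> \<phi>)"
  unfolding satisfies_cubic_relation_def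
proof (intro ballI conjI allI impI)
  fix C assume C: "C \<in> components (quadric \<delta> \<epsilon> \<phi>)"
  obtain J where J: "open J" "is_interval J" "J \<noteq> {}" "\<And>t. t \<in> J \<Longrightarrow> profile \<delta> \<epsilon> \<phi> t > 0"
    and CJ: "C - z_axis = {p \<in> quadric \<delta> \<epsilon> \<phi>. p$3 \<in> J}"
    using component_off_axis_slab[OF assms C] by blast
  obtain I x z where gen: "generatrix I x z" and "z ` I = J"
    and prof: "\<And>s. s \<in> I \<Longrightarrow> (x s)\<^sup>2 = profile \<delta> \<epsilon> \<phi> (z s)"
    using generatrix_over_interval[OF J] by blast
  have "rotational_surface I x z = C - z_axis"
    using rotational_surface_eq_slab[of I x \<delta> \<epsilon> \<phi> z] prof gen
    by (simp add: generatrix_def \<open>z ` I = J\<close> CJ)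
  with gen show "\<exists>I x z. generatrix I x z \<and> rotational_surface I x z = C - z_axis" by blast
next
  fix C I x z s
  assume C: "C \<in> components (quadric \<delta> \<epsilon> \<phi>)" and "s \<in> I"
    and gen: "generatrix I x z \<and> rotational_surface I x z = C - z_axis"
  have "(x t)\<^sup>2 = profile \<delta> \<epsilon> \<phi> (z t)" if "t \<in> I" for t
  proof -
    have "vector [x t * cos 0, x t * sin 0, z t] \<in> rotational_surface I x z"
      using that unfolding rotational_surface_def by blast
    then have "vector [x t * cos 0, x t * sin 0, z t] \<in> quadric \<delta> \<epsilon> \<phi>"
      using gen in_components_subset[OF C] by blast
    then show ?thesis unfolding circle_points .
  qed
  then show "k_m x z s = (\<epsilon>\<^sup>2 - \<delta> * \<phi>) * (k_p x z s)^3"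
    using cubic_relation_on_quadric gen \<open>s \<in> I\<close> by blast
qed

text \<open>
  Both principal curvatures vanish on a plane, so every \<open>\<mu>\<close> will do.
\<close>

lemma plane_satisfies_cubic_relation:
  assumes "horizontal_plane Q"
  shows "satisfies_cubic_relation \<mu> Q"
proof -
  obtain h where Q: "Q = {p. p$3 = h}" using assms unfolding horizontal_plane_def by blast
  have "convex Q"
    unfolding Q convex_def by (simp flip: distrib_right)
  moreover have "vector [0, 0, h] \<in> Q" by (simp add: Q vector_3)
  ultimately have comps: "components Q = {Q}"
    using components_eq_sing_iff convex_connected by blast
  have "\<exists>I x z. generatrix I x z \<and> rotational_surface I x z = Q - z_axis"
  proof (intro exI conjI)
    let ?I = "{0<..} :: real set" and ?x = "\<lambda>s :: real. s" and ?z = "\<lambda>s :: real. h"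
    have "smooth_on ?I ?x" "smooth_on ?I ?z"
    proof -
      have "smooth_on ?I f" if "f \<in> {?x, ?z}" for f
      proof (rule smooth_on_polynomial_system[OF _ that])
        fix g assume "g \<in> {?x, ?z}"
        then consider "g = ?x" | "g = ?z" by blast
        then show "\<exists>g'\<in>poly_algebra {?x, ?z}. \<forall>s\<in>?I. (g has_real_derivative g' s) (at s)"
          by cases (rule bexI[OF _ poly_algebra.const[of 1]], simp,
              rule bexI[OF _ poly_algebra.const[of 0]], simp)
      qed auto
      then show "smooth_on ?I ?x" "smooth_on ?I ?z" by auto
    qed
    then show "generatrix ?I ?x ?z"
      unfolding generatrix_def by (auto simp: is_interval_oi)
    have "rotational_surface ?I ?x ?z = {p. p$3 = h \<and> sqrt ((p$1)\<^sup>2 + (p$2)\<^sup>2) \<in> ?x ` ?I}"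
      by (rule rotational_surface_horizontal) auto
    then show "rotational_surface ?I ?x ?z = Q - z_axis"
      by (auto simp: Q z_axis_def sum_power2_gt_zero_iff)
  qed
  moreover have "k_m x z s = \<mu> * (k_p x z s)^3"
    if gen: "generatrix I x z" "rotational_surface I x z = Q - z_axis" and "s \<in> I" for I x z s
  proof -
    have "z t = h" if "t \<in> I" for t
    proof -
      have "vector [x t * cos 0, x t * sin 0, z t] \<in> rotational_surface I x z"
        using that unfolding rotational_surface_def by blast
      then show ?thesis using gen(2) by (auto simp: Q vector_3)
    qed
    moreover have "open I" using gen(1) unfolding generatrix_def by blast
    ultimately have z': "deriv z t = 0" if "t \<in> I" for t
      by (intro DERIV_imp_deriv has_field_derivative_transform_within_open[OF DERIV_const _ that])
        auto
    then have "deriv (deriv z) s = 0"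
      by (intro DERIV_imp_deriv
          has_field_derivative_transform_within_open[OF DERIV_const \<open>open I\<close> \<open>s \<in> I\<close>]) auto
    with z'[OF \<open>s \<in> I\<close>] show ?thesis by (simp add: k_m_def k_p_def)
  qed
  ultimately show ?thesis unfolding satisfies_cubic_relation_def comps by blast
qed

theorem theorem3p4:
  shows "(\<forall>I x z. generatrix I x z \<longrightarrow>
            (\<exists>\<mu>. \<mu> \<noteq> 0 \<and> (\<forall>s\<in>I. k_m x z s = \<mu> * (k_p x z s)^3)) \<longrightarrow>
            (\<exists>Q. (horizontal_plane Q \<or> nondegenerate_quadric_of_revolution Q) \<and>
                 openin (top_of_set Q) (rotational_surface I x z)))
       \<and> (\<forall>Q. horizontal_plane Q \<or> nondegenerate_quadric_of_revolution Q \<longrightarrow>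
            (\<exists>\<mu>. \<mu> \<noteq> 0 \<and> satisfies_cubic_relation \<mu> Q))"
proof (intro conjI allI impI)
  fix I x z
  assume "generatrix I x z" "\<exists>\<mu>. \<mu> \<noteq> 0 \<and> (\<forall>s\<in>I. k_m x z s = \<mu> * (k_p x z s)^3)"
  then show "\<exists>Q. (horizontal_plane Q \<or> nondegenerate_quadric_of_revolution Q) \<and>
                 openin (top_of_set Q) (rotational_surface I x z)"
    using cubic_relation_imp_open_piece by blast
next
  fix Q assume "horizontal_plane Q \<or> nondegenerate_quadric_of_revolution Q"
  then show "\<exists>\<mu>. \<mu> \<noteq> 0 \<and> satisfies_cubic_relation \<mu> Q"
  proof
    assume "horizontal_plane Q"
    then show ?thesis using plane_satisfies_cubic_relation[of Q 1] by (intro exI[of _ 1]) simp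
  next
    assume "nondegenerate_quadric_of_revolution Q"
    then show ?thesis
      using nondegenerate_imp_quadric quadric_satisfies_cubic_relation by metis
  qed
qed

end
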